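(* Let $F=\Bbbk\langle x,y\rangle$ and let $D$ be the $\Bbbk$-derivation of $F$ defined by $D(y)=0$ and $D(x)=1+[x,y]$, where $[x,y]=xy-yx$. Then $D$ is not locally nilpotent, whereas $\pi_\ast(D)=\partial_x$ is nonzero and locally nilpotent. Moreover, $\mathrm{Aut}_D(F)$ contains automorphisms of arbitrarily large degree, i.e. for every integer $d\ge1$ there is $\rho\in\mathrm{Aut}_D(F)$ with $\deg(\rho)\ge d$.
   Context: $\Bbbk$ is an algebraically closed field of characteristic zero and $F=\Bbbk\langle x,y\rangle$ is the free associative unital $\Bbbk$-algebra on two generators. $\pi:F\to\Bbbk[x,y]$ is the natural abelianization map ($x\mapsto x$, $y\mapsto y$), whose kernel $I$ is the two-sided ideal generated by $[x,y]$. Every $\Bbbk$-derivation $D$ of $F$ satisfies $D(I)\subseteq I$ and hence induces a $\Bbbk$-derivation $\pi_\ast(D)$ of $\Bbbk[x,y]$, characterized by $\pi_\ast(D)(\pi(a))=\pi(D(a))$ for all $a\in F$. For a $\Bbbk$-algebra automorphism $\rho$ of $F$, $\deg(\rho)=\max\{\deg(\rho(x)),\deg(\rho(y))\}$, where $\deg$ is the usual total degree of noncommutative polynomials in $x,y$. For a $\Bbbk$-derivation $D$ of a $\Bbbk$-algebra $A$, $\mathrm{Aut}_D(A)=\{\rho\in\mathrm{Aut}(A)\mid\rho D=D\rho\}$, where $\mathrm{Aut}(A)$ is the group of $\Bbbk$-algebra automorphisms; $D$ is locally nilpotent if for every $a\in A$ there is $n\ge1$ with $D^n(a)=0$. *)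

theory Defs
  imports "HOL-Library.Poly_Mapping" "HOL-Computational_Algebra.Polynomial"
begin

section \<open>The free algebra on two generators\<close>

text \<open>
  The free monoid of words, written additively (zero is the empty word, plus is concatenation):
  with this instance, \<^typ>\<open>'g list \<Rightarrow>\<^sub>0 'k\<close> with its library (convolution) product
  is the monoid algebra of the free monoid on \<^typ>\<open>'g\<close>, i.e. the free associative unital
  algebra on \<^typ>\<open>'g\<close>.
\<close>

instantiation list :: (type) monoid_add
begin
definition zero_list :: "'a list" where "zero_list = []"
definition plus_list :: "'a list \<Rightarrow> 'a list \<Rightarrow> 'a list" where "plus_list = append"
instance by standard (simp_all add: zero_list_def plus_list_def)
end

datatype gen = X | Y

type_synonym 'k free_alg = "gen list \<Rightarrow>\<^sub>0 'k"

definition fscale :: "'k \<Rightarrow> 'k free_alg \<Rightarrow> 'k::field free_alg"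
  where "fscale c a = Poly_Mapping.map ((*) c) a"

definition fX :: "'k::field free_alg" where "fX = Poly_Mapping.single [X] 1"
definition fY :: "'k::field free_alg" where "fY = Poly_Mapping.single [Y] 1"

definition commutator :: "'a::ring \<Rightarrow> 'a \<Rightarrow> 'a"
  where "commutator a b = a * b - b * a"

text \<open>Total degree, with the convention that the zero polynomial has degree \<open>0\<close>.\<close>

definition fdeg :: "'k::field free_alg \<Rightarrow> nat"
  where "fdeg a = Max (insert 0 (length ` Poly_Mapping.keys a))"

definition aut_deg :: "('k::field free_alg \<Rightarrow> 'k free_alg) \<Rightarrow> nat"
  where "aut_deg \<rho> = max (fdeg (\<rho> fX)) (fdeg (\<rho> fY))"


section \<open>The polynomial algebra in two commuting variables\<close>

text \<open>
  \<open>k[x,y]\<close> is rendered as \<open>k[y][x]\<close>: the outer variable is \<open>x\<close>, so that the partial derivative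
  with respect to \<open>x\<close> is \<^const>\<open>pderiv\<close>.
\<close>

type_synonym 'k poly2 = "'k poly poly"

definition pscale :: "'k \<Rightarrow> 'k poly2 \<Rightarrow> 'k::field poly2"
  where "pscale c p = smult [:c:] p"

definition pX :: "'k::field poly2" where "pX = [:0, 1:]"
definition pY :: "'k::field poly2" where "pY = [:[:0, 1:]:]"


section \<open>Derivations and automorphisms of algebras\<close>

text \<open>A \<open>k\<close>-algebra is given by a ring type together with its scalar multiplication \<open>s\<close>.\<close>

definition derivation :: "('k::field \<Rightarrow> 'a \<Rightarrow> 'a::ring_1) \<Rightarrow> ('a \<Rightarrow> 'a) \<Rightarrow> bool"
  where "derivation s D \<longleftrightarrow>
    Vector_Spaces.linear s s D \<and> (\<forall>a b. D (a * b) = D a * b + a * D b)"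

definition algebra_automorphism :: "('k::field \<Rightarrow> 'a \<Rightarrow> 'a::ring_1) \<Rightarrow> ('a \<Rightarrow> 'a) \<Rightarrow> bool"
  where "algebra_automorphism s \<rho> \<longleftrightarrow>
    Vector_Spaces.linear s s \<rho> \<and> \<rho> 1 = 1 \<and> (\<forall>a b. \<rho> (a * b) = \<rho> a * \<rho> b) \<and> bij \<rho>"

definition Aut_commuting :: "('k::field \<Rightarrow> 'a \<Rightarrow> 'a::ring_1) \<Rightarrow> ('a \<Rightarrow> 'a) \<Rightarrow> ('a \<Rightarrow> 'a) set"
  where "Aut_commuting s D = {\<rho>. algebra_automorphism s \<rho> \<and> \<rho> \<circ> D = D \<circ> \<rho>}"

definition locally_nilpotent :: "('a::zero \<Rightarrow> 'a) \<Rightarrow> bool"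
  where "locally_nilpotent D \<longleftrightarrow> (\<forall>a. \<exists>n\<ge>1. (D ^^ n) a = 0)"


section \<open>Abelianization\<close>

primrec gen_image :: "gen \<Rightarrow> 'k::field poly2" where
  "gen_image X = pX"
| "gen_image Y = pY"

definition abel :: "'k::field free_alg \<Rightarrow> 'k poly2"
  where "abel a = (\<Sum>w\<in>Poly_Mapping.keys a.
    pscale (Poly_Mapping.lookup a w) (prod_list (map gen_image w)))"

text \<open>The description determines the derivation uniquely; see \<open>induced_ex1\<close> below.\<close>

definition induced :: "('k::field free_alg \<Rightarrow> 'k free_alg) \<Rightarrow> 'k poly2 \<Rightarrow> 'k poly2"
  where "induced D = (THE E. derivation pscale E \<and> (\<forall>a. E (abel a) = abel (D a)))"


section \<open>Existence and uniqueness of the objects in use\<close>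

lemma fscale_conv_mult: "fscale c a = Poly_Mapping.single [] c * a"
  by (simp add: fscale_def mult_map_scale_conv_mult zero_list_def)

lemma lookup_fscale: "Poly_Mapping.lookup (fscale c a) w = c * Poly_Mapping.lookup a w"
  unfolding fscale_def by transfer (auto simp: when_def)

lemma vector_space_fscale: "vector_space (fscale :: 'k::field \<Rightarrow> _)"
  by unfold_locales
     (auto intro!: poly_mapping_eqI simp: lookup_fscale lookup_add algebra_simps)

lemma vector_space_pscale: "vector_space (pscale :: 'k::field \<Rightarrow> _)"
  unfolding pscale_def
  by unfold_locales
     (simp_all add: smult_add_right smult_add_left[symmetric] one_pCons[symmetric] mult.commute)

lemma free_alg_eq_sum:
  "a = (\<Sum>w\<in>Poly_Mapping.keys a. Poly_Mapping.single w (Poly_Mapping.lookup a w))"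
  by (rule poly_mapping_eqI)
     (auto simp: lookup_sum lookup_single when_def in_keys_iff)

lemma free_alg_induct [case_names zero single add]:
  fixes a :: "'k::field free_alg"
  assumes "P 0" "\<And>w c. P (Poly_Mapping.single w c)" "\<And>a b. P a \<Longrightarrow> P b \<Longrightarrow> P (a + b)"
  shows "P a"
proof -
  have "P (\<Sum>w\<in>A. Poly_Mapping.single w (Poly_Mapping.lookup a w))" if "finite A" for A
    using that by (induction A) (auto intro: assms)
  then show ?thesis using free_alg_eq_sum[of a] finite_keys by metis
qed

lemma single_mult_single:
  "Poly_Mapping.single u c * Poly_Mapping.single v d =
    Poly_Mapping.single (u @ v) (c * d :: 'k::field)"
  by (simp add: mult_single plus_list_def)

lemma fscale_single:
  "fscale c (Poly_Mapping.single w d) = Poly_Mapping.single w (c * d :: 'k::field)"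
  by (simp add: fscale_conv_mult single_mult_single)

lemma fscale_mult_left: "fscale c a * b = fscale c (a * b)"
  by (simp add: fscale_conv_mult mult.assoc)

lemma fscale_mult_right: "a * fscale c b = fscale c (a * (b :: 'k::field free_alg))"
proof -
  have "a * Poly_Mapping.single [] c = Poly_Mapping.single [] c * a"
    by (induction a rule: free_alg_induct)
       (simp_all add: single_mult_single distrib_left distrib_right mult.commute)
  then show ?thesis by (simp add: fscale_conv_mult flip: mult.assoc)
qed

lemma linear_addD: "Vector_Spaces.linear s t f \<Longrightarrow> f (a + b) = f a + f b"
  and linear_scaleD: "Vector_Spaces.linear s t f \<Longrightarrow> f (s c a) = t c (f a)"
  and linear_zeroD: "Vector_Spaces.linear s t f \<Longrightarrow> f 0 = 0"
  by (auto simp: linear_iff_module_hom module_hom.add module_hom.scale module_hom.zero)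

lemma single_Nil_one: "Poly_Mapping.single [] 1 = 1"
  by (simp flip: zero_list_def)

definition lin_ext :: "('k \<Rightarrow> 'a \<Rightarrow> 'a) \<Rightarrow> (gen list \<Rightarrow> 'a) \<Rightarrow> 'k::field free_alg \<Rightarrow> 'a::ring_1"
  where "lin_ext s f a = (\<Sum>w\<in>Poly_Mapping.keys a. s (Poly_Mapping.lookup a w) (f w))"

context
  fixes s :: "'k::field \<Rightarrow> 'a \<Rightarrow> 'a::ring_1"
  assumes vs: "vector_space s"
begin

lemma lin_ext_superset:
  assumes "finite A" "Poly_Mapping.keys a \<subseteq> A"
  shows "lin_ext s f a = (\<Sum>w\<in>A. s (Poly_Mapping.lookup a w) (f w))"
proof -
  interpret vector_space s by (rule vs)
  show ?thesis unfolding lin_ext_def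
    by (rule sum.mono_neutral_left) (use assms in \<open>auto simp: in_keys_iff\<close>)
qed

lemma lin_ext_linear: "Vector_Spaces.linear fscale s (lin_ext s f)"
proof -
  interpret F: vector_space "fscale :: 'k \<Rightarrow> _" by (rule vector_space_fscale)
  interpret vector_space s by (rule vs)
  have add: "lin_ext s f (a + b) = lin_ext s f a + lin_ext s f b" for a b
  proof -
    let ?A = "Poly_Mapping.keys a \<union> Poly_Mapping.keys b"
    have "Poly_Mapping.keys (a + b) \<subseteq> ?A" by (rule Poly_Mapping.keys_add)
    then show ?thesis
      by (simp add: lin_ext_superset[of ?A] lookup_add scale_left_distrib sum.distrib)
  qed
  have scale: "lin_ext s f (fscale c a) = s c (lin_ext s f a)" for c a
  proof -
    have "Poly_Mapping.keys (fscale c a) \<subseteq> Poly_Mapping.keys a"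
      by (auto simp: in_keys_iff lookup_fscale)
    then show ?thesis
      by (simp add: lin_ext_superset[of "Poly_Mapping.keys a"] lookup_fscale scale_sum_right)
  qed
  show ?thesis
    by unfold_locales (simp_all add: add scale)
qed

lemma lin_ext_add: "lin_ext s f (a + b) = lin_ext s f a + lin_ext s f b"
  by (rule linear_addD[OF lin_ext_linear])

lemma lin_ext_zero: "lin_ext s f 0 = 0"
  by (simp add: lin_ext_def)

lemma lin_ext_single: "lin_ext s f (Poly_Mapping.single w c) = s c (f w)"
proof -
  interpret vector_space s by (rule vs)
  show ?thesis by (simp add: lin_ext_superset[of "{w}"])
qed

end

primrec word_deriv ::
  "(gen \<Rightarrow> 'k free_alg) \<Rightarrow> gen list \<Rightarrow> 'k::field free_alg" where
  "word_deriv u [] = 0"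
| "word_deriv u (g # w) =
    u g * Poly_Mapping.single w 1 + Poly_Mapping.single [g] 1 * word_deriv u w"

lemma word_deriv_append:
  "word_deriv u (v @ w) =
    word_deriv u v * Poly_Mapping.single w 1 + Poly_Mapping.single v 1 * word_deriv u w"
proof (induction v)
  case Nil
  then show ?case by (simp add: single_Nil_one)
next
  case (Cons g v)
  have "Poly_Mapping.single (g # v) (1::'a) = Poly_Mapping.single [g] 1 * Poly_Mapping.single v 1"
    "Poly_Mapping.single (v @ w) (1::'a) = Poly_Mapping.single v 1 * Poly_Mapping.single w 1"
    by (simp_all add: single_mult_single)
  then show ?case by (simp add: Cons algebra_simps)
qed

lemma single_conv_fscale: "Poly_Mapping.single w c = fscale c (Poly_Mapping.single w 1)"
  by (simp add: fscale_single)

lemma derivation_exists: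
  "\<exists>D. derivation fscale D \<and> (\<forall>g. D (Poly_Mapping.single [g] 1) = u g)"
proof -
  interpret F: vector_space "fscale :: 'a \<Rightarrow> _" by (rule vector_space_fscale)
  let ?D = "lin_ext fscale (word_deriv u)"
  note add = lin_ext_add[OF vector_space_fscale]
  note zero = lin_ext_zero[OF vector_space_fscale]
  note single = lin_ext_single[OF vector_space_fscale]
  have "?D (a * b) = ?D a * b + a * ?D b" for a b
  proof (induction a rule: free_alg_induct)
    case (single v c)
    show ?case
    proof (induction b rule: free_alg_induct)
      case (single w d)
      have cv: "Poly_Mapping.single w c * a = fscale c (Poly_Mapping.single w 1 * a)"
        "a * Poly_Mapping.single w c = fscale c (a * Poly_Mapping.single w 1)"
        for w a and c :: 'a
        by (simp_all add: single_conv_fscale[of w c] fscale_mult_left fscale_mult_right)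
      show ?case
        by (simp add: lin_ext_single[OF vector_space_fscale] single_mult_single word_deriv_append
            cv[where w = v and c = c] cv[where w = w and c = d]
            fscale_mult_left fscale_mult_right F.scale_right_distrib mult.commute
            linear_scaleD[OF lin_ext_linear[OF vector_space_fscale]])
    qed (simp_all add: add zero algebra_simps)
  qed (simp_all add: add zero algebra_simps)
  moreover have "?D (Poly_Mapping.single [g] 1) = u g" for g
    by (simp add: single single_Nil_one F.scale_one)
  ultimately show ?thesis
    using lin_ext_linear[OF vector_space_fscale, of "word_deriv u"]
    unfolding derivation_def by blast
qed

lemma derivation_one: "derivation s D \<Longrightarrow> D 1 = 0"
  unfolding derivation_def by (metis add_cancel_right_right mult_1 mult_1_right)

text \<open>
  A derivation of the free algebra exists for any prescribed values on the generators; in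
  particular for the values considered in the theorem.
\<close>

lemma derivation_example_exists:
  "\<exists>D :: 'k::field free_alg \<Rightarrow> _.
    derivation fscale D \<and> D fY = 0 \<and> D fX = 1 + commutator fX fY"
proof -
  obtain D :: "'k free_alg \<Rightarrow> _" where "derivation fscale D"
    "\<forall>g. D (Poly_Mapping.single [g] 1) = (case g of X \<Rightarrow> 1 + commutator fX fY | Y \<Rightarrow> 0)"
    using derivation_exists[of "case_gen (1 + commutator fX fY) 0"] by blast
  then show ?thesis unfolding fX_def fY_def by (metis gen.simps(3,4))
qed

lemma abel_conv_lin_ext: "abel = lin_ext pscale (\<lambda>w. prod_list (map gen_image w))"
  by (rule ext) (simp add: abel_def lin_ext_def)

lemma abel_linear: "Vector_Spaces.linear fscale pscale abel"
  unfolding abel_conv_lin_ext by (rule lin_ext_linear[OF vector_space_pscale])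

lemma abel_add: "abel (a + b) = abel a + abel b"
  unfolding abel_conv_lin_ext by (rule lin_ext_add[OF vector_space_pscale])

lemma abel_single:
  "abel (Poly_Mapping.single w c) = pscale c (prod_list (map gen_image w))"
  unfolding abel_conv_lin_ext by (rule lin_ext_single[OF vector_space_pscale])

lemma abel_zero: "abel 0 = 0"
  by (simp add: abel_def)

lemma abel_one: "abel 1 = 1"
  using abel_single[of "[]" 1]
  by (simp add: pscale_def single_Nil_one one_pCons[symmetric])

lemma abel_fX: "abel fX = pX" and abel_fY: "abel fY = pY"
  by (simp_all add: fX_def fY_def abel_single pscale_def one_pCons[symmetric])

lemma abel_mult: "abel (a * b) = abel a * abel b"
proof (induction a rule: free_alg_induct)
  case (single v c)
  show ?case
  proof (induction b rule: free_alg_induct)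
    case (single w d)
    show ?case
      by (simp add: abel_single single_mult_single pscale_def mult.commute)
  qed (simp_all add: abel_add abel_zero algebra_simps)
qed (simp_all add: abel_add abel_zero algebra_simps)

lemma abel_surj: "\<exists>a. abel a = (p :: 'k::field poly2)"
proof (induction p)
  case 0
  show ?case using abel_zero by blast
next
  case (pCons q p)
  then obtain a where a: "abel a = p" by blast
  have "\<exists>b. abel b = [:q:]"
  proof (induction q)
    case 0
    show ?case using abel_zero by (metis pCons_0_0)
  next
    case (pCons c q)
    then obtain b where b: "abel b = [:q:]" by blast
    have "abel (Poly_Mapping.single [] c + fY * b) = [:pCons c q:]"
      by (simp add: abel_add abel_mult abel_fY b abel_single pscale_def pY_def)
    then show ?case by blast
  qed
  then obtain b where b: "abel b = [:q:]" by blast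
  have "abel (b + fX * a) = pCons q p"
    by (simp add: abel_add abel_mult abel_fX a b pX_def)
  then show ?case by blast
qed

definition partial_y :: "'k::field poly2 \<Rightarrow> 'k poly2"
  where "partial_y p = map_poly pderiv p"

lemma coeff_partial_y: "coeff (partial_y p) n = pderiv (coeff p n)"
  by (simp add: partial_y_def coeff_map_poly)

lemma pderiv_sum': "pderiv (sum f A) = (\<Sum>i\<in>A. pderiv (f i))"
  by (induction A rule: infinite_finite_induct) (simp_all add: pderiv_add)

lemma partial_y_mult: "partial_y (p * q) = partial_y p * q + p * partial_y q"
proof -
  have "pderiv (a * b) = pderiv a * b + a * pderiv b" for a b :: "'a poly"
    by (simp add: pderiv_mult)
  then show ?thesis
    by (intro poly_eqI) (simp add: coeff_partial_y coeff_mult pderiv_sum' sum.distrib)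
qed

lemma partial_y_one: "map_poly pderiv (1 :: 'k::field poly2) = 0"
  unfolding one_pCons by (simp add: map_poly_pCons pderiv_pCons)

lemma partial_y_add: "partial_y (p + q) = partial_y p + partial_y q"
  by (rule poly_eqI) (simp add: coeff_partial_y pderiv_add)

lemma partial_y_pscale: "partial_y (pscale c p) = pscale c (partial_y p)"
  by (rule poly_eqI) (simp add: coeff_partial_y pscale_def pderiv_smult)

lemma pderiv_pscale: "pderiv (pscale c p) = pscale c (pderiv (p :: 'k::field poly2))"
  by (simp add: pscale_def pderiv_smult)

lemma induced_exists:
  fixes D :: "'k::field free_alg \<Rightarrow> 'k free_alg"
  assumes D: "derivation fscale D"
  shows "\<exists>E. derivation pscale E \<and> (\<forall>a. E (abel a) = abel (D a))"
proof -
  interpret P: vector_space "pscale :: 'k \<Rightarrow> _" by (rule vector_space_pscale)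
  define E where "E p = abel (D fX) * pderiv p + abel (D fY) * partial_y p" for p
  have E_add: "E (p + q) = E p + E q" for p q
    by (simp add: E_def pderiv_add partial_y_add algebra_simps)
  have E_scale: "E (pscale c p) = pscale c (E p)" for c p
    by (simp add: E_def pderiv_pscale partial_y_pscale) (simp add: pscale_def smult_add_right)
  have E_mult: "E (p * q) = E p * q + p * E q" for p q
    by (simp add: E_def pderiv_mult partial_y_mult algebra_simps)
  have E: "derivation pscale E"
    unfolding derivation_def
    by (intro conjI allI E_mult, unfold_locales) (simp_all add: E_add E_scale)
  have lin: "Vector_Spaces.linear fscale fscale D" and
    D_mult: "D (a * b) = D a * b + a * D b" for a b
    using D by (auto simp: derivation_def)
  have word: "E (abel (Poly_Mapping.single w 1)) = abel (D (Poly_Mapping.single w 1))" for w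
  proof (induction w)
    case Nil
    then show ?case
      using derivation_one[OF D] derivation_one[OF E]
      by (simp add: abel_one abel_zero single_Nil_one)
  next
    case (Cons g w)
    have gen: "E (abel (Poly_Mapping.single [g] 1)) = abel (D (Poly_Mapping.single [g] 1))"
      by (cases g)
         (simp_all flip: fX_def fY_def add: abel_fX abel_fY,
          simp_all add: E_def pX_def pY_def partial_y_def pderiv_pCons map_poly_pCons
            partial_y_one flip: one_pCons)
    have "Poly_Mapping.single (g # w) (1::'k) =
        Poly_Mapping.single [g] 1 * Poly_Mapping.single w 1"
      by (simp add: single_mult_single)
    then show ?case by (simp add: abel_mult abel_add D_mult E_mult gen Cons)
  qed
  have "E (abel a) = abel (D a)" for a
  proof (induction a rule: free_alg_induct)
    case zero
    show ?case
      using linear_zeroD[OF lin] by (simp add: abel_zero E_def partial_y_def)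
  next
    case (single w c)
    show ?case
      by (simp add: single_conv_fscale[of w c] E_scale word linear_scaleD[OF lin]
          linear_scaleD[OF abel_linear])
  next
    case (add a b)
    then show ?case using linear_addD[OF lin] by (simp add: abel_add E_add)
  qed
  with E show ?thesis by blast
qed

lemma induced_ex1:
  assumes "derivation fscale D"
  shows "\<exists>!E. derivation pscale E \<and> (\<forall>a. E (abel a) = abel (D a))"
  using induced_exists[OF assms] by (rule ex_ex1I) (metis abel_surj ext)

end

theory Submission
  imports Defs
begin

text \<open>
  Write \<open>\<delta> a = [a, y]\<close>. Since \<open>D y = 0\<close>, the derivations \<open>D\<close> and \<open>\<delta>\<close> commute, so
  \<open>D x = 1 + \<delta> x\<close> gives \<open>D\<^sup>n x = \<delta>\<^sup>n x\<close> for all \<open>n \<ge> 2\<close>. This is never zero: bracketing with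
  \<open>y\<close> appends the letter \<open>y\<close> to a word, up to words that begin with \<open>y\<close>, so the word \<open>x y\<^sup>n\<close>
  keeps the coefficient \<open>1\<close> (\<open>iterate_coeff\<close>). Hence \<open>D\<close> is not locally nilpotent.

  After abelianization the bracket disappears, and the induced derivation sends \<open>x\<close> to \<open>1\<close> and \<open>y\<close>
  to \<open>0\<close>, as \<open>\<partial>\<^sub>x\<close> does. The latter lowers the degree in \<open>x\<close>, so it is locally nilpotent.

  Large automorphisms are the shears \<open>x \<mapsto> x + y\<^sup>d\<close>, \<open>y \<mapsto> y\<close>. The value \<open>D x = 1 + [x, y]\<close> does
  not change when something that commutes with \<open>y\<close> is added to \<open>x\<close>, and \<open>D\<close> kills \<open>y\<^sup>d\<close>; so the
  shear \<open>\<rho>\<close> satisfies \<open>\<rho> D = D \<rho>\<close> on the generators.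

  Both comparisons (\<open>\<partial>\<^sub>x\<close> with the induced derivation, \<open>\<rho> D\<close> with \<open>D \<rho>\<close>) are instances of
  one uniqueness principle: a derivation along a homomorphism out of the free algebra is determined
  by its values on \<open>x\<close> and \<open>y\<close> (\<open>derivation_along_eqI\<close>).
\<close>

section \<open>Maps determined by their values on the generators\<close>

lemma linear_eqI_words:
  assumes "Vector_Spaces.linear fscale s f" "Vector_Spaces.linear fscale s g"
    and "\<And>w. f (Poly_Mapping.single w 1) = g (Poly_Mapping.single w 1)"
  shows "f = g"
proof
  fix a
  show "f a = g a"
  proof (induction a rule: free_alg_induct)
    case (single w c)
    show ?case
      by (simp add: single_conv_fscale[of w c] linear_scaleD[OF assms(1)]
          linear_scaleD[OF assms(2)] assms(3))
  qed (simp_all add: linear_addD[OF assms(1)] linear_addD[OF assms(2)]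
      linear_zeroD[OF assms(1)] linear_zeroD[OF assms(2)])
qed

lemma single_Cons: "Poly_Mapping.single (g # w) (1 :: 'k::field) =
    Poly_Mapping.single [g] 1 * Poly_Mapping.single w 1"
  by (simp add: single_mult_single)

lemma single_generator: "Poly_Mapping.single [g] 1 = (case g of X \<Rightarrow> fX | Y \<Rightarrow> fY)"
  by (cases g) (simp_all add: fX_def fY_def)

definition algebra_hom :: "('k::field \<Rightarrow> 'a \<Rightarrow> 'a::ring_1) \<Rightarrow> ('k free_alg \<Rightarrow> 'a) \<Rightarrow> bool"
  where "algebra_hom s \<phi> \<longleftrightarrow>
    Vector_Spaces.linear fscale s \<phi> \<and> \<phi> 1 = 1 \<and> (\<forall>a b. \<phi> (a * b) = \<phi> a * \<phi> b)"

lemma algebra_hom_power: "algebra_hom s \<phi> \<Longrightarrow> \<phi> (a ^ n) = \<phi> a ^ n"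
  by (induction n) (simp_all add: algebra_hom_def)

lemma algebra_hom_eqI:
  assumes "algebra_hom s \<phi>" "algebra_hom s \<psi>" "\<phi> fX = \<psi> fX" "\<phi> fY = \<psi> fY"
  shows "\<phi> = \<psi>"
proof (rule linear_eqI_words)
  fix w
  have gen: "\<phi> (Poly_Mapping.single [g] 1) = \<psi> (Poly_Mapping.single [g] 1)" for g
    using assms(3,4) by (cases g) (simp_all add: single_generator)
  show "\<phi> (Poly_Mapping.single w 1) = \<psi> (Poly_Mapping.single w 1)"
  proof (induction w)
    case Nil
    then show ?case using assms(1,2) by (simp add: single_Nil_one algebra_hom_def)
  next
    case (Cons g w)
    then show ?case
      using assms(1,2) gen[of g] by (simp add: single_Cons[of g w] algebra_hom_def)
  qed
qed (use assms(1,2) in \<open>auto simp: algebra_hom_def\<close>)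

definition derivation_along ::
  "('k::field \<Rightarrow> 'a \<Rightarrow> 'a::ring_1) \<Rightarrow> ('k free_alg \<Rightarrow> 'a) \<Rightarrow> ('k free_alg \<Rightarrow> 'a) \<Rightarrow> bool"
  where "derivation_along s \<phi> d \<longleftrightarrow>
    Vector_Spaces.linear fscale s d \<and> (\<forall>a b. d (a * b) = d a * \<phi> b + \<phi> a * d b)"

text \<open>
  The Leibniz rule along \<open>\<phi>\<close> forces the value \<open>0\<close> at the empty word and reduces a longer
  word to its first letter and the rest. The twist by \<open>\<phi>\<close> is what makes the principle
  applicable to \<open>\<phi> \<circ> D\<close> and \<open>E \<circ> \<phi>\<close>, which are not themselves derivations of one algebra.
\<close>

lemma derivation_along_eqI:
  assumes "\<phi> 1 = 1" "derivation_along s \<phi> d" "derivation_along s \<phi> e"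
    "d fX = e fX" "d fY = e fY"
  shows "d = e"
proof (rule linear_eqI_words)
  fix w
  have one: "h 1 = 0" if "derivation_along s \<phi> h" for h
    using that assms(1) unfolding derivation_along_def
    by (metis add_cancel_right_right mult_1 mult_1_right)
  have gen: "d (Poly_Mapping.single [g] 1) = e (Poly_Mapping.single [g] 1)" for g
    using assms(4,5) by (cases g) (simp_all add: single_generator)
  show "d (Poly_Mapping.single w 1) = e (Poly_Mapping.single w 1)"
  proof (induction w)
    case Nil
    then show ?case using assms(2,3) by (simp add: single_Nil_one one)
  next
    case (Cons g w)
    then show ?case
      using assms(2,3) gen[of g] by (simp add: single_Cons[of g w] derivation_along_def)
  qed
qed (use assms(2,3) in \<open>auto simp: derivation_along_def\<close>)

lemma derivation_along_compose_hom:
  assumes "derivation s D" "algebra_hom s \<phi>"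
  shows "derivation_along s \<phi> (D \<circ> \<phi>)"
  using assms Vector_Spaces.linear_compose[of fscale s \<phi> s D]
  by (auto simp: derivation_def algebra_hom_def derivation_along_def)

lemma derivation_along_hom_compose:
  assumes "derivation fscale D" "algebra_hom s \<phi>"
  shows "derivation_along s \<phi> (\<phi> \<circ> D)"
  using assms Vector_Spaces.linear_compose[of fscale fscale D s \<phi>]
  by (auto simp: derivation_def algebra_hom_def derivation_along_def linear_addD)


section \<open>Iterating the derivation\<close>

lemma commutator_fY_derivation:
  assumes "derivation fscale D" "D fY = 0"
  shows "D (commutator a fY) = commutator (D a) fY"
proof -
  have "Vector_Spaces.linear fscale fscale D" using assms by (simp add: derivation_def)
  then interpret D: Vector_Spaces.linear fscale fscale D .
  show ?thesis using assms by (simp add: derivation_def commutator_def D.diff)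
qed

text \<open>
  The constant \<open>1\<close> in \<open>D x\<close> matters only for the first iterate: \<open>D\<close> kills it, and from then
  on \<open>D\<close> acts as bracketing with \<open>y\<close>.
\<close>

lemma derivation_iterate:
  assumes "derivation fscale D" "D fY = 0" "D fX = 1 + commutator fX fY"
  shows "(D ^^ Suc (Suc n)) fX = commutator ((D ^^ Suc n) fX) fY"
proof (induction n)
  case 0
  have "D (1 + b) = D b" for b
    using assms(1) derivation_one[OF assms(1)] by (auto simp: derivation_def linear_addD)
  then show ?case using commutator_fY_derivation[OF assms(1,2)] by (simp add: assms(3))
next
  case (Suc n)
  then show ?case using commutator_fY_derivation[OF assms(1,2)] by simp
qed

text \<open>
  A word that begins with \<open>x\<close> and ends with \<open>y\<close> does not occur in \<open>y a\<close>, and occurs in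
  \<open>a y\<close> with the coefficient that the word without its last letter has in \<open>a\<close>.
\<close>

lemma lookup_commutator_fY:
  "Poly_Mapping.lookup (commutator a fY) (X # w @ [Y]) = Poly_Mapping.lookup a (X # w)"
proof (induction a rule: free_alg_induct)
  case (add a b)
  then show ?case by (simp add: commutator_def algebra_simps lookup_add lookup_minus)
qed (auto simp: commutator_def fY_def single_mult_single lookup_minus lookup_single when_def)

lemma iterate_coeff:
  fixes D :: "'k::field free_alg \<Rightarrow> 'k free_alg"
  assumes "derivation fscale D" "D fY = 0" "D fX = 1 + commutator fX fY"
  shows "Poly_Mapping.lookup ((D ^^ Suc n) fX) (X # replicate (Suc n) Y) = 1"
proof (induction n)
  case 0
  have "Poly_Mapping.lookup 1 [X, Y] = (0 :: 'k)"
    by (simp flip: single_Nil_one add: lookup_single)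
  moreover have "Poly_Mapping.lookup fX [X] = (1 :: 'k)"
    by (simp add: fX_def)
  ultimately show ?case
    using lookup_commutator_fY[of "fX :: 'k free_alg" "[]"] by (simp add: assms(3) lookup_add)
next
  case (Suc n)
  have "replicate (Suc (Suc n)) Y = replicate (Suc n) Y @ [Y]"
    by (simp add: replicate_append_same)
  then show ?case
    using Suc lookup_commutator_fY by (metis derivation_iterate[OF assms])
qed

lemma not_locally_nilpotent:
  assumes "derivation fscale D" "D fY = 0" "D fX = 1 + commutator fX fY"
  shows "\<not> locally_nilpotent D"
proof
  assume "locally_nilpotent D"
  then obtain n where "n \<ge> 1" "(D ^^ n) fX = 0" by (auto simp: locally_nilpotent_def)
  then show False using iterate_coeff[OF assms, of "n - 1"] by simp
qed


section \<open>The derivation induced on commuting polynomials\<close>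

lemma algebra_hom_abel: "algebra_hom pscale abel"
  by (simp add: algebra_hom_def abel_linear abel_one abel_mult)

lemma derivation_pderiv: "derivation pscale (pderiv :: 'k::field poly2 \<Rightarrow> _)"
proof -
  interpret P: vector_space "pscale :: 'k \<Rightarrow> _" by (rule vector_space_pscale)
  have "Vector_Spaces.linear pscale pscale (pderiv :: 'k poly2 \<Rightarrow> _)"
    by unfold_locales (simp_all add: pderiv_add pderiv_pscale)
  then show ?thesis by (simp add: derivation_def pderiv_mult algebra_simps)
qed

lemma induced_eq_pderiv:
  assumes "derivation fscale D" "D fY = 0" "D fX = 1 + commutator fX fY"
  shows "induced D = pderiv"
proof -
  have "pderiv \<circ> abel = abel \<circ> D"
  proof (rule derivation_along_eqI[where \<phi> = abel and s = pscale])
    have "abel (commutator fX fY :: 'a free_alg) = 0"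
      unfolding commutator_def
      by (metis abel_add abel_mult add_diff_cancel_right' diff_add_cancel diff_self mult.commute)
    then show "(pderiv \<circ> abel) fX = (abel \<circ> D) fX"
      by (simp add: assms abel_fX abel_add abel_one pX_def pderiv_pCons)
    show "(pderiv \<circ> abel) fY = (abel \<circ> D) fY"
      by (simp add: assms abel_fY abel_zero pY_def pderiv_pCons)
  qed (simp_all add: abel_one derivation_along_compose_hom derivation_along_hom_compose
      derivation_pderiv algebra_hom_abel assms)
  then have "derivation pscale pderiv \<and> (\<forall>a. pderiv (abel a) = abel (D a))"
    using derivation_pderiv by (auto simp: fun_eq_iff)
  then show ?thesis
    unfolding induced_def by (rule the1_equality[OF induced_ex1[OF assms(1)]])
qed

lemma pderiv_funpow_eq_0:
  fixes p :: "'a::{comm_semiring_1,semiring_no_zero_divisors,semiring_char_0} poly"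
  shows "degree p < n \<Longrightarrow> (pderiv ^^ n) p = 0"
proof (induction n arbitrary: p)
  case (Suc n)
  show ?case
  proof (cases "degree p = 0")
    case True
    then have "pderiv p = 0" by (simp add: pderiv_eq_0_iff)
    moreover have "(pderiv ^^ n) (0 :: 'a poly) = 0" by (induction n) simp_all
    ultimately show ?thesis by (simp add: funpow_swap1)
  next
    case False
    then show ?thesis using Suc by (simp add: funpow_swap1 degree_pderiv)
  qed
qed simp

lemma locally_nilpotent_pderiv:
  "locally_nilpotent
    (pderiv :: 'a::{comm_semiring_1,semiring_no_zero_divisors,semiring_char_0} poly \<Rightarrow> _)"
  unfolding locally_nilpotent_def by (metis Suc_le_mono le0 lessI One_nat_def pderiv_funpow_eq_0)


section \<open>Shears commuting with the derivation\<close>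

definition subst :: "(gen \<Rightarrow> 'k free_alg) \<Rightarrow> 'k::field free_alg \<Rightarrow> 'k free_alg"
  where "subst u = lin_ext fscale (\<lambda>w. prod_list (map u w))"

lemma subst_single: "subst u (Poly_Mapping.single w c) = fscale c (prod_list (map u w))"
  by (simp add: subst_def lin_ext_single vector_space_fscale)

lemma algebra_hom_subst: "algebra_hom fscale (subst u)"
proof -
  interpret F: vector_space "fscale :: 'a \<Rightarrow> _" by (rule vector_space_fscale)
  have lin: "Vector_Spaces.linear fscale fscale (subst u)"
    unfolding subst_def by (rule lin_ext_linear[OF vector_space_fscale])
  have "subst u (a * b) = subst u a * subst u b" for a b
  proof (induction a rule: free_alg_induct)
    case (single v c)
    show ?case
    proof (induction b rule: free_alg_induct)
      case (single w d)
      show ?case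
        by (simp add: subst_single single_mult_single fscale_mult_left fscale_mult_right)
    qed (simp_all add: linear_addD[OF lin] linear_zeroD[OF lin] algebra_simps)
  qed (simp_all add: linear_addD[OF lin] linear_zeroD[OF lin] algebra_simps)
  moreover have "subst u 1 = 1"
    using subst_single[of u "[]" 1] by (simp add: single_Nil_one F.scale_one)
  ultimately show ?thesis using lin by (simp add: algebra_hom_def)
qed

definition shear :: "'k::field free_alg \<Rightarrow> 'k free_alg \<Rightarrow> 'k free_alg"
  where "shear p = subst (case_gen (fX + p) fY)"

lemma shear_fX: "shear p fX = fX + p" and shear_fY: "shear p fY = fY"
proof -
  interpret F: vector_space "fscale :: 'a \<Rightarrow> _" by (rule vector_space_fscale)
  show "shear p fX = fX + p" "shear p fY = fY"
    by (simp_all add: shear_def fX_def fY_def subst_single F.scale_one)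
qed

lemma algebra_hom_shear: "algebra_hom fscale (shear p)"
  by (simp add: shear_def algebra_hom_subst)

lemma shear_fY_power: "shear p (fY ^ n) = fY ^ n"
  by (simp add: algebra_hom_power[OF algebra_hom_shear] shear_fY)

text \<open>
  Shears compose additively as long as the outer one fixes the shift of the inner one; this makes
  the shears by powers of \<open>y\<close> invertible, with inverse the shear by the opposite shift.
\<close>

lemma shear_shear:
  assumes "shear q p = p"
  shows "shear q \<circ> shear p = shear (p + q)"
proof (rule algebra_hom_eqI)
  show "algebra_hom fscale (shear q \<circ> shear p)"
    using algebra_hom_shear[of p] algebra_hom_shear[of q]
      Vector_Spaces.linear_compose[of fscale fscale "shear p" fscale "shear q"]
    by (auto simp: algebra_hom_def)
  show "(shear q \<circ> shear p) fX = shear (p + q) fX"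
    using linear_addD[of fscale fscale "shear q" fX p] algebra_hom_shear[of q]
    by (simp add: algebra_hom_def shear_fX assms algebra_simps)
qed (simp_all add: algebra_hom_shear shear_fY)

lemma shear_0: "shear 0 = id"
proof (rule algebra_hom_eqI)
  interpret F: vector_space "fscale :: 'a \<Rightarrow> _" by (rule vector_space_fscale)
  show "algebra_hom fscale (id :: 'a free_alg \<Rightarrow> _)"
    using F.linear_id by (simp add: algebra_hom_def id_def)
qed (simp_all add: algebra_hom_shear shear_fX shear_fY)

lemma shear_automorphism:
  assumes "shear p p = p" "shear (- p) p = p"
  shows "algebra_automorphism fscale (shear p)"
proof -
  have "shear p (- p) = - p"
  proof -
    have "Vector_Spaces.linear fscale fscale (shear p)"
      using algebra_hom_shear[of p] by (simp add: algebra_hom_def)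
    then interpret S: Vector_Spaces.linear fscale fscale "shear p" .
    show ?thesis by (simp add: S.neg assms)
  qed
  then have "shear (- p) \<circ> shear p = id" "shear p \<circ> shear (- p) = id"
    using shear_shear[of "- p" p] shear_shear[of p "- p"] assms by (simp_all add: shear_0)
  then have "bij (shear p)" using o_bij by blast
  then show ?thesis
    using algebra_hom_shear[of p] by (auto simp: algebra_automorphism_def algebra_hom_def)
qed

text \<open>
  Both hypotheses on \<open>p\<close> enter at the generator \<open>x\<close>: since \<open>p\<close> commutes with \<open>y\<close>, the value
  \<open>1 + [x, y]\<close> is fixed by the shear, and since \<open>D p = 0\<close>, it is also the value of \<open>D\<close> at
  \<open>x + p\<close>.
\<close>

lemma shear_derivation_commute:
  assumes "derivation fscale D" "D fY = 0" "D fX = 1 + commutator fX fY"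
    and "D p = 0" "p * fY = fY * p"
  shows "shear p \<circ> D = D \<circ> shear p"
proof (rule derivation_along_eqI[where \<phi> = "shear p" and s = fscale])
  have hom: "shear p 1 = 1" "\<And>a b. shear p (a * b) = shear p a * shear p b"
    and "Vector_Spaces.linear fscale fscale (shear p)"
    using algebra_hom_shear[of p] by (auto simp: algebra_hom_def)
  then interpret S: Vector_Spaces.linear fscale fscale "shear p" by simp
  have lin: "Vector_Spaces.linear fscale fscale D"
    using assms by (simp add: derivation_def)
  have "shear p (D fX) = 1 + commutator (fX + p) fY"
    by (simp add: assms commutator_def S.add S.diff hom shear_fX shear_fY)
  also have "\<dots> = D (fX + p)"
    using assms by (simp add: linear_addD[OF lin] commutator_def algebra_simps)
  finally show "(shear p \<circ> D) fX = (D \<circ> shear p) fX" by (simp add: shear_fX)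
  show "(shear p \<circ> D) fY = (D \<circ> shear p) fY"
    by (simp add: assms shear_fY S.zero)
  show "shear p 1 = 1" by (rule hom)
qed (simp_all add: derivation_along_compose_hom derivation_along_hom_compose
    algebra_hom_shear assms)

lemma derivation_fY_power:
  assumes "derivation fscale D" "D fY = 0"
  shows "D (fY ^ n) = 0"
  using assms derivation_one[OF assms(1)] by (induction n) (simp_all add: derivation_def)

lemma shear_fY_power_in_Aut_commuting:
  assumes "derivation fscale D" "D fY = 0" "D fX = 1 + commutator fX fY"
  shows "shear (fY ^ n) \<in> Aut_commuting fscale D"
  using shear_automorphism[of "fY ^ n"] shear_derivation_commute[OF assms, of "fY ^ n"]
    derivation_fY_power[OF assms(1,2)]
  by (simp add: Aut_commuting_def shear_fY_power power_commutes)

lemma fY_power: "fY ^ n = Poly_Mapping.single (replicate n Y) (1 :: 'k::field)"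
  by (induction n) (simp_all add: single_Nil_one fY_def single_mult_single)

text \<open>
  The word \<open>y\<^sup>n\<close> survives in \<open>x + y\<^sup>n\<close> because it differs from \<open>x\<close>.
\<close>

lemma aut_deg_shear_fY_power: "n \<le> aut_deg (shear (fY ^ n :: 'k::field free_alg))"
proof -
  have "replicate n Y \<noteq> [X]" by (cases n) auto
  then have "replicate n Y \<in> Poly_Mapping.keys (fX + fY ^ n :: 'k free_alg)"
    by (simp add: fX_def fY_power in_keys_iff lookup_add lookup_single when_def)
  then have "n \<in> length ` Poly_Mapping.keys (fX + fY ^ n :: 'k free_alg)"
    by (metis imageI length_replicate)
  then have "n \<le> fdeg (fX + fY ^ n :: 'k free_alg)"
    unfolding fdeg_def by (intro Max_ge) auto
  then show ?thesis by (simp add: aut_deg_def shear_fX)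
qed

theorem proposition29:
  fixes D :: "'k::{alg_closed_field, field_char_0} free_alg \<Rightarrow> 'k free_alg"
  assumes "derivation fscale D"
    and "D fY = 0"
    and "D fX = 1 + commutator fX fY"
  shows "\<not> locally_nilpotent D \<and>
    induced D = pderiv \<and> induced D \<noteq> (\<lambda>p. 0) \<and> locally_nilpotent (induced D) \<and>
    (\<forall>d::nat. d \<ge> 1 \<longrightarrow> (\<exists>\<rho> \<in> Aut_commuting fscale D. aut_deg \<rho> \<ge> d))"
proof -
  have "pderiv (pX :: 'k poly2) \<noteq> 0" by (simp add: pX_def pderiv_pCons)
  then have "(pderiv :: 'k poly2 \<Rightarrow> _) \<noteq> (\<lambda>p. 0)" by metis
  then show ?thesis
    using not_locally_nilpotent[OF assms] induced_eq_pderiv[OF assms] locally_nilpotent_pderiv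
      shear_fY_power_in_Aut_commuting[OF assms] aut_deg_shear_fY_power
    by auto
qed

end
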